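(* Let $n\ge 3$, and consider the polynomial ring $\mathbb{Q}[a_0,\ldots,a_{n-1},r_1,\ldots,r_n]$ in $2n$ indeterminates. For $i=1,\ldots,n$ let $s_i$ be the elementary symmetric polynomial of degree $i$ in $r_1,\ldots,r_n$ and $v_i=a_{n-i}-(-1)^i s_i$. Let $D_2\in\mathbb{Q}[a_0,\ldots,a_{n-1}]$ be the polynomial obtained by expressing the symmetric polynomial $\prod_{1\le i,j,k\le n,\ i<j,\ j\ne k,\ k\ne i}(2r_k-r_i-r_j)$ in terms of $a_{n-i}=(-1)^i s_i$. Then \begin{align*} \Big\langle \prod_{\substack{1\le i,j,k\le n\\ i<j,\ j\ne k,\ k\ne i}}(2r_k-r_i-r_j),\,v_1,\ldots,v_n\Big\rangle\cap\mathbb{Q}[a_0,\ldots,a_{n-1}] &=\langle 2r_1-r_2-r_3,\,v_1,\ldots,v_n\rangle\cap\mathbb{Q}[a_0,\ldots,a_{n-1}]\\ &=\langle D_2\rangle . \end{align*}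
   Context: $\langle g_1,\ldots,g_m\rangle$ denotes the ideal generated by $g_1,\ldots,g_m$ (in the ring containing the generators). *)

theory Defs
  imports Complex_Main "HOL-Library.Poly_Mapping"
begin

text \<open>Multivariate polynomials over the rationals in variables indexed by nat:
  a polynomial maps monomials (exponent vectors nat to nat, finitely supported) to rational coefficients.
  Convention: a_j (0 \<le> j \<le> n-1) is variable j, and r_i (1 \<le> i \<le> n) is variable n + i - 1.\<close>

type_synonym mpoly = "(nat \<Rightarrow>\<^sub>0 nat) \<Rightarrow>\<^sub>0 rat"

definition Var :: "nat \<Rightarrow> mpoly" where
  "Var v = Poly_Mapping.single (Poly_Mapping.single v 1) 1"

definition Const :: "rat \<Rightarrow> mpoly" where
  "Const c = Poly_Mapping.single 0 c"

definition avar :: "nat \<Rightarrow> mpoly" where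
  "avar j = Var j"

definition rvar :: "nat \<Rightarrow> nat \<Rightarrow> mpoly" where
  "rvar n i = Var (n + i - 1)"

definition esym :: "nat \<Rightarrow> nat \<Rightarrow> mpoly" where
  "esym n i = (\<Sum>S\<in>{S. S \<subseteq> {1..n} \<and> card S = i}. \<Prod>j\<in>S. rvar n j)"

definition vgen :: "nat \<Rightarrow> nat \<Rightarrow> mpoly" where
  "vgen n i = avar (n - i) - (-1) ^ i * esym n i"

definition in_Qa :: "nat \<Rightarrow> mpoly \<Rightarrow> bool" where
  "in_Qa n (p::mpoly) \<longleftrightarrow> (\<forall>m\<in>Poly_Mapping.keys p. \<forall>v\<in>Poly_Mapping.keys m. v < n)"

definition ideal_gen :: "mpoly list \<Rightarrow> mpoly set" where
  "ideal_gen gs = {\<Sum>i<length gs. c i * gs ! i | c. True}"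

definition subst :: "(nat \<Rightarrow> mpoly) \<Rightarrow> mpoly \<Rightarrow> mpoly" where
  "subst \<sigma> p = (\<Sum>m\<in>Poly_Mapping.keys p. Const (Poly_Mapping.lookup p m) * (\<Prod>v\<in>Poly_Mapping.keys m. \<sigma> v ^ Poly_Mapping.lookup m v))"

definition Pprod :: "nat \<Rightarrow> mpoly" where
  "Pprod n = (\<Prod>(i,j,k)\<in>{(i,j,k). i \<in> {1..n} \<and> j \<in> {1..n} \<and> k \<in> {1..n} \<and> i < j \<and> j \<noteq> k \<and> k \<noteq> i}.
               2 * rvar n k - rvar n i - rvar n j)"

definition a_to_s :: "nat \<Rightarrow> nat \<Rightarrow> mpoly" where
  "a_to_s n v = (if v < n then (-1) ^ (n - v) * esym n (n - v) else Var v)"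

end

theory Submission
  imports Defs "HOL-Combinatorics.Permutations"
begin

text \<open>
  Let \<open>\<phi>\<close> be the homomorphism \<open>a\<^sub>n\<^sub>-\<^sub>i \<mapsto> (-1)\<^sup>i s\<^sub>i\<close>, which fixes all other variables. Modulo
  \<open>v\<^sub>1, \<dots>, v\<^sub>n\<close> every \<open>p\<close> is congruent to \<open>\<phi> p\<close>, so for \<open>g\<close> in the \<open>r\<close>-variables alone,
  \<open>p\<close> lies in \<open>\<langle>g, v\<^sub>1, \<dots>, v\<^sub>n\<rangle>\<close> iff \<open>g\<close> divides \<open>\<phi> p\<close>. For \<open>p\<close> in the \<open>a\<close>-variables, \<open>\<phi> p\<close> is
  symmetric in the \<open>r\<close>-variables; hence if \<open>2r\<^sub>1 - r\<^sub>2 - r\<^sub>3\<close> divides it, so do all the conjugates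
  of this linear form. These are pairwise non-associated primes, so their product divides \<open>\<phi> p\<close>.
  The quotient is again symmetric, and the fundamental theorem on symmetric polynomials
  (\<open>\<phi>\<close> maps the polynomials in the \<open>a\<close>-variables bijectively onto the symmetric ones) yields
  \<open>p = c D\<^sub>2\<close>. The fundamental theorem is proved by comparing lexicographically leading monomials.
\<close>

subsection \<open>Substitution homomorphisms\<close>

definition monom_at :: "(nat \<Rightarrow> mpoly) \<Rightarrow> (nat \<Rightarrow>\<^sub>0 nat) \<Rightarrow> mpoly" where
  "monom_at \<sigma> m = (\<Prod>v\<in>Poly_Mapping.keys m. \<sigma> v ^ Poly_Mapping.lookup m v)"

lemma subst_altdef:
  "subst \<sigma> p = (\<Sum>m\<in>Poly_Mapping.keys p. Const (Poly_Mapping.lookup p m) * monom_at \<sigma> m)"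
  by (simp add: subst_def monom_at_def)

lemma monom_at_superset:
  assumes "finite A" "Poly_Mapping.keys m \<subseteq> A"
  shows "monom_at \<sigma> m = (\<Prod>v\<in>A. \<sigma> v ^ Poly_Mapping.lookup m v)"
  unfolding monom_at_def using assms by (intro prod.mono_neutral_left) (auto simp: in_keys_iff)

lemma monom_at_0 [simp]: "monom_at \<sigma> 0 = 1"
  by (simp add: monom_at_def)

lemma monom_at_add: "monom_at \<sigma> (m + m') = monom_at \<sigma> m * monom_at \<sigma> m'"
proof -
  let ?A = "Poly_Mapping.keys m \<union> Poly_Mapping.keys m'"
  have "monom_at \<sigma> (m + m') = (\<Prod>v\<in>?A. \<sigma> v ^ Poly_Mapping.lookup (m + m') v)"
    by (rule monom_at_superset) (auto simp: Poly_Mapping.keys_add)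
  also have "\<dots> = (\<Prod>v\<in>?A. \<sigma> v ^ Poly_Mapping.lookup m v) * (\<Prod>v\<in>?A. \<sigma> v ^ Poly_Mapping.lookup m' v)"
    by (simp add: lookup_add power_add prod.distrib)
  finally show ?thesis
    by (simp add: monom_at_superset[of ?A])
qed

lemma Const_0 [simp]: "Const 0 = 0" and Const_1 [simp]: "Const 1 = 1"
  by (simp_all add: Const_def)

lemma Const_add: "Const (a + b) = Const a + Const b"
  by (simp add: Const_def single_add)

lemma Const_diff: "Const (a - b) = Const a - Const b"
  by (simp add: Const_def single_diff)

lemma Const_mult: "Const (a * b) = Const a * Const b"
  by (simp add: Const_def mult_single)

lemma Const_numeral [simp]: "Const (numeral k) = numeral k"
  by (simp add: Const_def)

lemma Const_eq_0_iff [simp]: "Const c = 0 \<longleftrightarrow> c = 0"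
  by (metis Const_0 Const_def lookup_single_eq)

lemma subst_0 [simp]: "subst \<sigma> 0 = 0"
  by (simp add: subst_def)

lemma subst_single: "subst \<sigma> (Poly_Mapping.single m c) = Const c * monom_at \<sigma> m"
  by (simp add: subst_altdef)

lemma subst_Const [simp]: "subst \<sigma> (Const c) = Const c"
  by (simp add: Const_def subst_single)

lemma subst_1 [simp]: "subst \<sigma> 1 = 1"
  using subst_Const[of \<sigma> 1] by simp

lemma subst_numeral [simp]: "subst \<sigma> (numeral k) = numeral k"
  using subst_Const[of \<sigma> "numeral k"] by simp

lemma subst_Var [simp]: "subst \<sigma> (Var v) = \<sigma> v"
  by (simp add: Var_def subst_single monom_at_def)

lemma subst_add: "subst \<sigma> (p + q) = subst \<sigma> p + subst \<sigma> q"
  unfolding subst_altdef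
  \<comment> \<open>Cancellation may shrink the support of \<open>p + q\<close>; it suffices that
    the summand is additive in the coefficient and vanishes at coefficient 0.\<close>
  by (rule setsum_keys_plus_distrib) (simp_all add: Const_add distrib_right)

lemma subst_uminus: "subst \<sigma> (- p) = - subst \<sigma> p"
  using subst_add[of \<sigma> p "- p"] by (simp add: eq_neg_iff_add_eq_0 add.commute)

lemma subst_diff: "subst \<sigma> (p - q) = subst \<sigma> p - subst \<sigma> q"
  using subst_add[of \<sigma> p "- q"] by (simp add: subst_uminus)

lemma subst_sum: "subst \<sigma> (\<Sum>x\<in>A. f x) = (\<Sum>x\<in>A. subst \<sigma> (f x))"
  by (induction A rule: infinite_finite_induct) (simp_all add: subst_add)

lemma sum_of_monomials: "(\<Sum>m\<in>Poly_Mapping.keys p. Poly_Mapping.single m (Poly_Mapping.lookup p m)) = p"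
  by (rule poly_mapping_eqI) (auto simp: lookup_sum lookup_single when_def in_keys_iff)

text \<open>Expanding both factors into monomials reduces the claim to
  \<open>monom_at_add\<close>.\<close>

lemma subst_mult: "subst \<sigma> (p * q) = subst \<sigma> p * subst \<sigma> q"
proof -
  let ?s = "\<lambda>p m. Poly_Mapping.single m (Poly_Mapping.lookup p m)"
  have "subst \<sigma> (p * q) = subst \<sigma> ((\<Sum>m\<in>Poly_Mapping.keys p. ?s p m) * (\<Sum>m\<in>Poly_Mapping.keys q. ?s q m))"
    by (simp add: sum_of_monomials)
  also have "\<dots> = (\<Sum>m\<in>Poly_Mapping.keys p. \<Sum>m'\<in>Poly_Mapping.keys q. subst \<sigma> (?s p m) * subst \<sigma> (?s q m'))"
    by (simp add: sum_product subst_sum subst_single mult_single monom_at_add Const_mult ac_simps)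
  also have "\<dots> = subst \<sigma> (\<Sum>m\<in>Poly_Mapping.keys p. ?s p m) * subst \<sigma> (\<Sum>m\<in>Poly_Mapping.keys q. ?s q m)"
    by (simp add: sum_product subst_sum)
  finally show ?thesis by (simp add: sum_of_monomials)
qed

lemma subst_power: "subst \<sigma> (p ^ k) = subst \<sigma> p ^ k"
  by (induction k) (simp_all add: subst_mult)

lemma subst_prod: "subst \<sigma> (\<Prod>x\<in>A. f x) = (\<Prod>x\<in>A. subst \<sigma> (f x))"
  by (induction A rule: infinite_finite_induct) (simp_all add: subst_mult)

lemmas subst_hom = subst_add subst_diff subst_uminus subst_mult subst_power subst_sum subst_prod

lemma subst_monom_at: "subst \<tau> (monom_at \<sigma> m) = monom_at (\<lambda>v. subst \<tau> (\<sigma> v)) m"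
  by (simp add: monom_at_def subst_hom)

lemma subst_subst: "subst \<tau> (subst \<sigma> p) = subst (\<lambda>v. subst \<tau> (\<sigma> v)) p"
  by (simp add: subst_altdef[of \<sigma>] subst_altdef[of "\<lambda>v. subst \<tau> (\<sigma> v)"] subst_hom subst_monom_at)

lemma monom_at_Var: "monom_at Var m = Poly_Mapping.single m 1"
proof -
  have pow: "Var v ^ k = Poly_Mapping.single (Poly_Mapping.single v k) 1" for v k
  proof (induction k)
    case (Suc k)
    then show ?case by (simp add: Var_def mult_single single_add[symmetric])
  qed simp
  have prd: "(\<Prod>v\<in>A. Poly_Mapping.single (f v) (1::rat)) = Poly_Mapping.single (\<Sum>v\<in>A. f v) 1"
    for f :: "nat \<Rightarrow> (nat \<Rightarrow>\<^sub>0 nat)" and A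
    by (induction A rule: infinite_finite_induct) (simp_all add: mult_single)
  have "(\<Sum>v\<in>Poly_Mapping.keys m. Poly_Mapping.single v (Poly_Mapping.lookup m v)) = m"
    by (rule poly_mapping_eqI) (auto simp: lookup_sum lookup_single when_def in_keys_iff)
  then show ?thesis
    by (simp add: monom_at_def pow prd)
qed

text \<open>Makes \<open>p\<close> itself a substitution instance, so that comparing
  \<open>p\<close> with \<open>subst \<sigma> p\<close> means comparing two substitutions.\<close>

lemma subst_Var_id: "subst Var p = p"
  using sum_of_monomials[of p]
  by (simp add: subst_altdef monom_at_Var Const_def mult_single)

subsection \<open>Variables occurring in a polynomial\<close>

text \<open>An arbitrary variable set \<open>A\<close> serves the a-variables \<open>{..<n}\<close>
  and the r-variables alike.\<close>

definition vars_in :: "nat set \<Rightarrow> mpoly \<Rightarrow> bool" where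
  "vars_in A p \<longleftrightarrow> (\<forall>m\<in>Poly_Mapping.keys p. Poly_Mapping.keys m \<subseteq> A)"

lemma in_Qa_iff_vars_in: "in_Qa n p \<longleftrightarrow> vars_in {..<n} p"
  by (auto simp: in_Qa_def vars_in_def)

lemma vars_in_UNIV [simp]: "vars_in UNIV p"
  by (simp add: vars_in_def)

lemma vars_in_Const [simp]: "vars_in A (Const c)"
  by (simp add: vars_in_def Const_def)

lemma vars_in_0 [simp]: "vars_in A 0" and vars_in_1 [simp]: "vars_in A 1"
  by (simp_all add: vars_in_def)

lemma vars_in_numeral [simp]: "vars_in A (numeral k)"
  using vars_in_Const[of A "numeral k"] by simp

lemma vars_in_Var [simp]: "v \<in> A \<Longrightarrow> vars_in A (Var v)"
  by (simp add: vars_in_def Var_def)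

lemma vars_in_add: "vars_in A p \<Longrightarrow> vars_in A q \<Longrightarrow> vars_in A (p + q)"
  unfolding vars_in_def using Poly_Mapping.keys_add[of p q] by blast

lemma vars_in_uminus: "vars_in A p \<Longrightarrow> vars_in A (- p)"
  by (simp add: vars_in_def)

lemma vars_in_diff: "vars_in A p \<Longrightarrow> vars_in A q \<Longrightarrow> vars_in A (p - q)"
  using vars_in_add[of A p "- q"] by (simp add: vars_in_uminus)

lemma vars_in_mult:
  assumes "vars_in A p" "vars_in A q" shows "vars_in A (p * q)"
  unfolding vars_in_def
proof
  fix m assume "m \<in> Poly_Mapping.keys (p * q)"
  then obtain a b where "m = a + b" "a \<in> Poly_Mapping.keys p" "b \<in> Poly_Mapping.keys q"
    using keys_mult[of p q] by blast
  then show "Poly_Mapping.keys m \<subseteq> A"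
    using assms Poly_Mapping.keys_add[of a b] unfolding vars_in_def by blast
qed

lemma vars_in_power: "vars_in A p \<Longrightarrow> vars_in A (p ^ k)"
  by (induction k) (simp_all add: vars_in_mult)

lemma vars_in_sum: "(\<And>x. x \<in> I \<Longrightarrow> vars_in A (f x)) \<Longrightarrow> vars_in A (\<Sum>x\<in>I. f x)"
  by (induction I rule: infinite_finite_induct) (simp_all add: vars_in_add)

lemma vars_in_prod: "(\<And>x. x \<in> I \<Longrightarrow> vars_in A (f x)) \<Longrightarrow> vars_in A (\<Prod>x\<in>I. f x)"
  by (induction I rule: infinite_finite_induct) (simp_all add: vars_in_mult)

lemma vars_in_subst:
  assumes "vars_in A p" "\<And>v. v \<in> A \<Longrightarrow> vars_in B (\<sigma> v)"
  shows "vars_in B (subst \<sigma> p)"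
  using assms unfolding subst_def vars_in_def[of A]
  by (intro vars_in_sum vars_in_mult vars_in_prod vars_in_power vars_in_Const) auto

lemma subst_cong:
  assumes "vars_in A p" "\<And>v. v \<in> A \<Longrightarrow> \<sigma> v = \<tau> v"
  shows "subst \<sigma> p = subst \<tau> p"
  unfolding subst_def
proof (intro sum.cong refl arg_cong2[of _ _ _ _ times] prod.cong)
  fix m v assume "m \<in> Poly_Mapping.keys p" "v \<in> Poly_Mapping.keys m"
  then have "v \<in> A" using assms(1) by (auto simp: vars_in_def)
  then show "\<sigma> v ^ Poly_Mapping.lookup m v = \<tau> v ^ Poly_Mapping.lookup m v"
    using assms(2) by simp
qed

lemma subst_id_on:
  assumes "vars_in A p" "\<And>v. v \<in> A \<Longrightarrow> \<sigma> v = Var v"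
  shows "subst \<sigma> p = p"
  using subst_cong[of A p \<sigma> Var] assms subst_Var_id by simp

subsection \<open>Ideals\<close>

lemma ideal_gen_add:
  assumes "p \<in> ideal_gen gs" "q \<in> ideal_gen gs" shows "p + q \<in> ideal_gen gs"
proof -
  from assms obtain c d where "p = (\<Sum>i<length gs. c i * gs ! i)" "q = (\<Sum>i<length gs. d i * gs ! i)"
    by (auto simp: ideal_gen_def)
  then have "p + q = (\<Sum>i<length gs. (c i + d i) * gs ! i)"
    by (simp add: sum.distrib distrib_right)
  then show ?thesis unfolding ideal_gen_def by (intro CollectI exI[of _ "\<lambda>i. c i + d i"]) simp
qed

lemma ideal_gen_mult:
  assumes "p \<in> ideal_gen gs" shows "q * p \<in> ideal_gen gs"
proof -
  from assms obtain c where "p = (\<Sum>i<length gs. c i * gs ! i)"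
    by (auto simp: ideal_gen_def)
  then have "q * p = (\<Sum>i<length gs. (q * c i) * gs ! i)"
    by (simp add: sum_distrib_left mult.assoc)
  then show ?thesis unfolding ideal_gen_def by (intro CollectI exI[of _ "\<lambda>i. q * c i"]) simp
qed

lemma ideal_gen_0: "0 \<in> ideal_gen gs"
  unfolding ideal_gen_def by (intro CollectI exI[of _ "\<lambda>i. 0"]) simp

lemma ideal_gen_generator:
  assumes "g \<in> set gs" shows "g \<in> ideal_gen gs"
proof -
  obtain k where k: "k < length gs" "gs ! k = g" using assms by (auto simp: in_set_conv_nth)
  have "(\<Sum>i<length gs. (if i = k then 1 else 0) * gs ! i) = (\<Sum>i<length gs. if k = i then gs ! i else 0)"
    by (rule sum.cong) auto
  also have "\<dots> = g" using k by simp
  finally show ?thesis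
    unfolding ideal_gen_def by (intro CollectI exI[of _ "\<lambda>i. if i = k then 1 else 0"]) simp
qed

lemma ideal_gen_sum: "(\<And>x. x \<in> A \<Longrightarrow> f x \<in> ideal_gen gs) \<Longrightarrow> (\<Sum>x\<in>A. f x) \<in> ideal_gen gs"
  by (induction A rule: infinite_finite_induct) (simp_all add: ideal_gen_add ideal_gen_0)

lemma ideal_gen_singleton: "p \<in> ideal_gen [g] \<longleftrightarrow> g dvd p"
  by (auto simp: ideal_gen_def dvd_def mult.commute)

text \<open>Telescoping: the factors are exchanged one at a time.\<close>

lemma ideal_gen_prod_congruent:
  assumes "\<And>x. x \<in> A \<Longrightarrow> f x - g x \<in> ideal_gen gs"
  shows "(\<Prod>x\<in>A. f x) - (\<Prod>x\<in>A. g x) \<in> ideal_gen gs"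
  using assms
proof (induction A rule: infinite_finite_induct)
  case (insert a A)
  have "(\<Prod>x\<in>insert a A. f x) - (\<Prod>x\<in>insert a A. g x)
      = f a * ((\<Prod>x\<in>A. f x) - (\<Prod>x\<in>A. g x)) + (\<Prod>x\<in>A. g x) * (f a - g a)"
    using insert.hyps by (simp add: algebra_simps)
  also have "\<dots> \<in> ideal_gen gs"
    using insert by (intro ideal_gen_add ideal_gen_mult) auto
  finally show ?case .
qed (simp_all add: ideal_gen_0)

lemma ideal_gen_power_congruent:
  assumes "f - g \<in> ideal_gen gs" shows "f ^ k - g ^ k \<in> ideal_gen gs"
  using ideal_gen_prod_congruent[of "{..<k}" "\<lambda>_. f" "\<lambda>_. g" gs] assms by simp

text \<open>Congruence of the variables passes to powers, monomials and linear combinations. It is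
  applied both to the relations \<open>v_i\<close> and to a single linear form.\<close>

lemma ideal_gen_subst_congruent:
  assumes "\<And>v. Var v - \<sigma> v \<in> ideal_gen gs"
  shows "p - subst \<sigma> p \<in> ideal_gen gs"
proof -
  have "p - subst \<sigma> p = subst Var p - subst \<sigma> p"
    by (simp add: subst_Var_id)
  also have "\<dots> = (\<Sum>m\<in>Poly_Mapping.keys p. Const (Poly_Mapping.lookup p m) * (monom_at Var m - monom_at \<sigma> m))"
    by (simp add: subst_altdef sum_subtractf right_diff_distrib)
  also have "\<dots> \<in> ideal_gen gs"
    unfolding monom_at_def
    by (intro ideal_gen_sum ideal_gen_mult ideal_gen_prod_congruent ideal_gen_power_congruent assms)
  finally show ?thesis .
qed

subsection \<open>Lexicographically leading monomials\<close>

text \<open>The library order is lexicographic with the smallest variable index dominating, so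
  \<open>r_1\<close> weighs most among the r-variables.\<close>

lemma less_monom_iff:
  "m < m' \<longleftrightarrow> (\<exists>k. Poly_Mapping.lookup m k < Poly_Mapping.lookup m' k \<and>
      (\<forall>k'<k. Poly_Mapping.lookup m k' = Poly_Mapping.lookup m' k'))"
  for m m' :: "nat \<Rightarrow>\<^sub>0 nat"
  by (simp add: less_poly_mapping.rep_eq less_fun_def)

text \<open>With infinitely many variables the order has infinite descents (the single variables
  with increasing index). Inside a finite window of variables it is the lexicographic order on lists
  of fixed length.\<close>

lemma wf_less_monom:
  "wf {(m :: nat \<Rightarrow>\<^sub>0 nat, m'). m < m' \<and> Poly_Mapping.keys m \<subseteq> {a..<b} \<and> Poly_Mapping.keys m' \<subseteq> {a..<b}}"
    (is "wf ?R")
  for a b :: nat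
proof (rule wf_subset)
  let ?f = "\<lambda>m :: nat \<Rightarrow>\<^sub>0 nat. map (Poly_Mapping.lookup m) [a..<b]"
  show "wf (inv_image (lexn less_than (b - a)) ?f)"
    by (intro wf_inv_image wf_lexn wf_less_than)
  show "?R \<subseteq> inv_image (lexn less_than (b - a)) ?f"
  proof (rule subrelI)
    fix m m' :: "nat \<Rightarrow>\<^sub>0 nat"
    assume "(m, m') \<in> ?R"
    then have "m < m'" and keys: "Poly_Mapping.keys m \<subseteq> {a..<b}" "Poly_Mapping.keys m' \<subseteq> {a..<b}"
      by auto
    from \<open>m < m'\<close> obtain k where k: "Poly_Mapping.lookup m k < Poly_Mapping.lookup m' k"
      and eq: "\<And>k'. k' < k \<Longrightarrow> Poly_Mapping.lookup m k' = Poly_Mapping.lookup m' k'"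
      unfolding less_monom_iff by blast
    have "k \<in> Poly_Mapping.keys m'" using k by (simp add: in_keys_iff)
    then have "a \<le> k" "k < b" using keys by auto
    \<comment> \<open>Cutting at the first differing index exhibits the common prefix required by
      \<open>lexn\<close>.\<close>
    then have upt: "[a..<b] = [a..<k] @ k # [Suc k..<b]"
      using upt_add_eq_append[of a k "b - k"] upt_conv_Cons[of k b] by simp
    have "?f m = map (Poly_Mapping.lookup m') [a..<k] @ Poly_Mapping.lookup m k # map (Poly_Mapping.lookup m) [Suc k..<b]"
      unfolding upt using eq by simp
    moreover have "?f m' = map (Poly_Mapping.lookup m') [a..<k] @ Poly_Mapping.lookup m' k # map (Poly_Mapping.lookup m') [Suc k..<b]"
      unfolding upt by simp
    ultimately show "(m, m') \<in> inv_image (lexn less_than (b - a)) ?f"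
      using k \<open>a \<le> k\<close> \<open>k < b\<close> by (simp only: in_inv_image lexn_conv) (auto simp del: map_append)
  qed
qed

text \<open>A relation rather than a function: the zero polynomial simply has no leading
  monomial.\<close>

definition has_lead :: "mpoly \<Rightarrow> (nat \<Rightarrow>\<^sub>0 nat) \<Rightarrow> bool" where
  "has_lead p m \<longleftrightarrow> m \<in> Poly_Mapping.keys p \<and> (\<forall>m'\<in>Poly_Mapping.keys p. m' \<le> m)"

lemma has_lead_exists:
  assumes "p \<noteq> 0" obtains m where "has_lead p m"
proof
  show "has_lead p (Max (Poly_Mapping.keys p))"
    using assms by (simp add: has_lead_def)
qed

lemma has_lead_uminus: "has_lead p m \<Longrightarrow> has_lead (- p) m"
  by (simp add: has_lead_def)

lemma lookup_mult_keys:
  "Poly_Mapping.lookup (p * q :: mpoly) k = (\<Sum>a\<in>Poly_Mapping.keys p. \<Sum>b\<in>Poly_Mapping.keys q.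
      if a + b = k then Poly_Mapping.lookup p a * Poly_Mapping.lookup q b else 0)"
proof -
  let ?s = "\<lambda>p m. Poly_Mapping.single m (Poly_Mapping.lookup p m)"
  have "Poly_Mapping.lookup (p * q) k
      = Poly_Mapping.lookup ((\<Sum>m\<in>Poly_Mapping.keys p. ?s p m) * (\<Sum>m\<in>Poly_Mapping.keys q. ?s q m)) k"
    by (simp add: sum_of_monomials)
  then show ?thesis
    by (simp add: sum_product lookup_sum mult_single lookup_single when_def)
qed

text \<open>The order is compatible with addition, so only one pair of keys sums to
  \<open>m + m'\<close>, and its coefficient is a product of two nonzero rationals.\<close>

lemma has_lead_mult:
  assumes p: "has_lead p m" and q: "has_lead q m'" shows "has_lead (p * q) (m + m')"
proof -
  have uniq: "a = m \<and> b = m'"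
    if "a \<in> Poly_Mapping.keys p" "b \<in> Poly_Mapping.keys q" "a + b = m + m'" for a b
  proof -
    have le: "a \<le> m" "b \<le> m'" using that p q by (auto simp: has_lead_def)
    have "a = m"
    proof (rule ccontr)
      assume "a \<noteq> m"
      then have "a + b < m + m'" using le by (intro add_less_le_mono) auto
      then show False using that by simp
    qed
    then show ?thesis using that by simp
  qed
  have "Poly_Mapping.lookup (p * q) (m + m') = (\<Sum>a\<in>Poly_Mapping.keys p. \<Sum>b\<in>Poly_Mapping.keys q.
      if a = m \<and> b = m' then Poly_Mapping.lookup p m * Poly_Mapping.lookup q m' else 0)"
    unfolding lookup_mult_keys by (intro sum.cong refl) (use uniq in auto)
  also have "\<dots> = (\<Sum>a\<in>Poly_Mapping.keys p. if m = a then \<Sum>b\<in>Poly_Mapping.keys q.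
      if m' = b then Poly_Mapping.lookup p m * Poly_Mapping.lookup q m' else 0 else 0)"
    by (intro sum.cong refl) auto
  also have "\<dots> = Poly_Mapping.lookup p m * Poly_Mapping.lookup q m'"
    using p q by (simp add: has_lead_def)
  finally have "m + m' \<in> Poly_Mapping.keys (p * q)"
    using p q by (simp add: has_lead_def in_keys_iff)
  moreover have "k \<le> m + m'" if "k \<in> Poly_Mapping.keys (p * q)" for k
    using that keys_mult[of p q] p q by (force simp: has_lead_def intro: add_mono)
  ultimately show ?thesis by (simp add: has_lead_def)
qed

lemma has_lead_prod:
  assumes "\<And>x. x \<in> A \<Longrightarrow> has_lead (f x) (g x)"
  shows "has_lead (\<Prod>x\<in>A. f x) (\<Sum>x\<in>A. g x)"
  using assms
proof (induction A rule: infinite_finite_induct)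
  case (insert x A)
  then show ?case by (simp add: has_lead_mult)
qed (simp_all add: has_lead_def)

lemma has_lead_power: "has_lead p m \<Longrightarrow> has_lead (p ^ k) (\<Sum>i<k. m)"
  using has_lead_prod[of "{..<k}" "\<lambda>_. p" "\<lambda>_. m"] by simp

lemma has_lead_minus_one_power_mult:
  assumes "has_lead p m" shows "has_lead ((-1) ^ k * p) m"
  using assms by (cases "even k") (simp_all add: has_lead_uminus)

subsection \<open>Symmetric polynomials\<close>

text \<open>The indices \<open>n + i - 1\<close> of the variables \<open>r_i\<close>.\<close>

abbreviation rset :: "nat \<Rightarrow> nat set" where
  "rset n \<equiv> {n..<2 * n}"

text \<open>Exponent vector of the squarefree monomial with support \<open>S\<close>.\<close>

definition ind :: "nat set \<Rightarrow> (nat \<Rightarrow>\<^sub>0 nat)" where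
  "ind S = (\<Sum>v\<in>S. Poly_Mapping.single v 1)"

lemma lookup_ind: "finite S \<Longrightarrow> Poly_Mapping.lookup (ind S) v = (if v \<in> S then 1 else 0)"
  by (simp add: ind_def lookup_sum lookup_single when_def)

lemma ind_inject:
  assumes "finite S" "finite T" shows "ind S = ind T \<longleftrightarrow> S = T"
proof
  assume "ind S = ind T"
  with assms have "(if v \<in> S then 1 else 0 :: nat) = (if v \<in> T then 1 else 0)" for v
    by (metis lookup_ind)
  then show "S = T" by (metis zero_neq_one subsetI subset_antisym)
qed simp

lemma prod_Var: "(\<Prod>v\<in>S. Var v) = Poly_Mapping.single (ind S) 1"
  by (induction S rule: infinite_finite_induct) (simp_all add: ind_def Var_def mult_single)

text \<open>Summing over sets of variable indices lets permutations and the monomial order act on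
  the index sets directly.\<close>

lemma esym_altdef: "esym n i = (\<Sum>S\<in>{S. S \<subseteq> rset n \<and> card S = i}. \<Prod>v\<in>S. Var v)"
proof -
  let ?h = "\<lambda>j. n + j - 1" and ?g = "\<lambda>v. v + 1 - n"
  have hg: "?h ` ?g ` T = T" if "T \<subseteq> rset n" for T
    using that by (force simp: image_image)
  have gh: "?g ` ?h ` S = S" if "S \<subseteq> {1..n}" for S
    using that by (force simp: image_image)
  have injh: "inj_on ?h S" if "S \<subseteq> {1..n}" for S
    using that by (auto simp: inj_on_def dest!: subsetD)
  have injg: "inj_on ?g T" if "T \<subseteq> rset n" for T
    using that by (auto simp: inj_on_def dest!: subsetD)
  show ?thesis
    unfolding esym_def
  proof (rule sum.reindex_bij_witness[of _ "image ?g" "image ?h"])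
    fix S assume S: "S \<in> {S. S \<subseteq> {1..n} \<and> card S = i}"
    then show "?g ` ?h ` S = S" using gh by auto
    show "?h ` S \<in> {S. S \<subseteq> rset n \<and> card S = i}"
      using S injh[of S] by (force simp: card_image)
    show "(\<Prod>v\<in>?h ` S. Var v) = (\<Prod>j\<in>S. rvar n j)"
      using S injh[of S] by (simp add: prod.reindex rvar_def)
  next
    fix T assume T: "T \<in> {S. S \<subseteq> rset n \<and> card S = i}"
    then show "?h ` ?g ` T = T" using hg by auto
    show "?g ` T \<in> {S. S \<subseteq> {1..n} \<and> card S = i}"
      using T injg[of T] by (force simp: card_image)
  qed
qed

lemma vars_in_esym: "vars_in (rset n) (esym n i)"
  unfolding esym_altdef by (intro vars_in_sum vars_in_prod vars_in_Var) auto

text \<open>Low indices dominate, so the initial segment wins among the \<open>i\<close>-subsets of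
  \<open>rset n\<close>.\<close>

lemma has_lead_esym:
  assumes "i \<le> n" shows "has_lead (esym n i) (ind {n..<n + i})"
proof -
  let ?I = "{n..<n + i}" and ?C = "{S. S \<subseteq> rset n \<and> card S = i}"
  have fin: "finite ?C" by (rule finite_subset[of _ "Pow (rset n)"]) auto
  have finS: "finite S" if "S \<in> ?C" for S using that finite_subset[of S "rset n"] by simp
  have I: "?I \<in> ?C" using assms by auto
  have esym: "esym n i = (\<Sum>S\<in>?C. Poly_Mapping.single (ind S) 1)"
    by (simp add: esym_altdef prod_Var)
  have "Poly_Mapping.lookup (esym n i) (ind ?I) = (\<Sum>S\<in>?C. if ?I = S then 1 else 0)"
    unfolding esym lookup_sum
  proof (rule sum.cong)
    fix S assume "S \<in> ?C"
    then show "Poly_Mapping.lookup (Poly_Mapping.single (ind S) 1) (ind ?I) = (if ?I = S then 1 else 0 :: rat)"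
      using finS[of S] ind_inject[of S ?I] by (auto simp: lookup_single when_def)
  qed simp
  also have "\<dots> = 1" using fin I by simp
  finally have "ind ?I \<in> Poly_Mapping.keys (esym n i)" by (simp add: in_keys_iff)
  moreover have "m \<le> ind ?I" if mem: "m \<in> Poly_Mapping.keys (esym n i)" for m
  proof -
    obtain S where S: "S \<in> ?C" and m: "m = ind S"
      using mem keys_sum[of "\<lambda>S. Poly_Mapping.single (ind S) (1::rat)" ?C] unfolding esym by auto
    have fS: "finite S" using finS S by blast
    show ?thesis
    proof (cases "S = ?I")
      case False
      have "\<not> ?I \<subseteq> S"
        using False S fS card_subset_eq[of S ?I] by auto
      \<comment> \<open>The first place where the two indicators differ: below it \<open>S\<close>
        contains the segment, and \<open>S\<close> has no elements below \<open>n\<close>.\<close>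
      define k where "k = (LEAST k. k \<in> ?I - S)"
      have k: "k \<in> ?I - S"
        unfolding k_def using \<open>\<not> ?I \<subseteq> S\<close> by (metis DiffI LeastI subsetI)
      have below: "k' \<in> S" if "k' \<in> ?I" "k' < k" for k'
        using not_less_Least[of k' "\<lambda>k. k \<in> ?I - S"] that unfolding k_def by blast
      have "Poly_Mapping.lookup (ind S) k' = Poly_Mapping.lookup (ind ?I) k'" if "k' < k" for k'
        using below[of k'] that k S fS by (auto simp: lookup_ind dest: subsetD)
      then have "ind S < ind ?I"
        unfolding less_monom_iff using k fS by (intro exI[of _ k]) (simp add: lookup_ind)
      then show ?thesis using m by simp
    qed (simp add: m)
  qed
  ultimately show ?thesis by (simp add: has_lead_def)
qed

definition symmetric :: "nat \<Rightarrow> mpoly \<Rightarrow> bool" where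
  "symmetric n f \<longleftrightarrow> (\<forall>\<tau>. \<tau> permutes rset n \<longrightarrow> subst (\<lambda>v. Var (\<tau> v)) f = f)"

lemma symmetric_diff: "symmetric n p \<Longrightarrow> symmetric n q \<Longrightarrow> symmetric n (p - q)"
  by (simp add: symmetric_def subst_diff)

lemma symmetric_mult: "symmetric n p \<Longrightarrow> symmetric n q \<Longrightarrow> symmetric n (p * q)"
  by (simp add: symmetric_def subst_mult)

lemma symmetric_Const: "symmetric n (Const c)"
  by (simp add: symmetric_def)

text \<open>A permutation of the variables permutes the \<open>i\<close>-subsets, hence only
  reorders the summands.\<close>

lemma permute_esym:
  assumes "\<tau> permutes rset n"
  shows "subst (\<lambda>v. Var (\<tau> v)) (esym n i) = esym n i"
proof -
  have inj: "inj \<tau>" using assms by (rule permutes_inj)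
  have inv: "inv \<tau> permutes rset n" using assms by (rule permutes_inv)
  have prod: "(\<Prod>v\<in>S. Var (\<tau> v)) = (\<Prod>v\<in>\<tau> ` S. Var v)" for S
    using inj by (simp add: prod.reindex inj_on_subset)
  have img: "\<pi> ` S \<subseteq> rset n" if "\<pi> permutes rset n" "S \<subseteq> rset n" for \<pi> S
    using that permutes_image by blast
  have "(\<Sum>S\<in>{S. S \<subseteq> rset n \<and> card S = i}. \<Prod>v\<in>\<tau> ` S. Var v)
      = (\<Sum>S\<in>{S. S \<subseteq> rset n \<and> card S = i}. \<Prod>v\<in>S. Var v)"
  proof (rule sum.reindex_bij_witness[of _ "image (inv \<tau>)" "image \<tau>"])
    fix S assume S: "S \<in> {S. S \<subseteq> rset n \<and> card S = i}"
    show "inv \<tau> ` \<tau> ` S = S" using inj by (simp add: image_inv_f_f)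
    show "\<tau> ` S \<in> {S. S \<subseteq> rset n \<and> card S = i}"
      using S img[OF assms, of S] inj by (simp add: card_image inj_on_subset)
    show "\<tau> ` inv \<tau> ` S = S" using permutes_surj[OF assms] by (simp add: image_f_inv_f)
    show "inv \<tau> ` S \<in> {S. S \<subseteq> rset n \<and> card S = i}"
      using S img[OF inv, of S] permutes_inj[OF inv] by (simp add: card_image inj_on_subset)
  qed simp
  then show ?thesis by (simp add: esym_altdef subst_hom prod)
qed

lemma symmetric_subst_a_to_s:
  assumes "vars_in {..<n} p" shows "symmetric n (subst (a_to_s n) p)"
  unfolding symmetric_def
proof (intro allI impI)
  fix \<tau> assume "\<tau> permutes rset n"
  then show "subst (\<lambda>v. Var (\<tau> v)) (subst (a_to_s n) p) = subst (a_to_s n) p"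
    unfolding subst_subst using assms
    by (intro subst_cong[of "{..<n}"]) (simp_all add: a_to_s_def subst_hom permute_esym)
qed

lemma vars_in_subst_a_to_s:
  assumes "vars_in {..<n} p" shows "vars_in (rset n) (subst (a_to_s n) p)"
  by (rule vars_in_subst[OF assms])
    (auto simp: a_to_s_def intro!: vars_in_mult vars_in_power vars_in_uminus vars_in_esym)

text \<open>Swapping two adjacent variables preserves \<open>f\<close>, so the swapped monomial
  occurs in it too. It would exceed \<open>m\<close> if the exponent went up from \<open>u\<close>
  to \<open>Suc u\<close>.\<close>

lemma symmetric_lead_decreasing:
  assumes sym: "symmetric n f" and lead: "has_lead f m" and u: "n \<le> u" "Suc u < 2 * n"
  shows "Poly_Mapping.lookup m (Suc u) \<le> Poly_Mapping.lookup m u"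
proof (rule ccontr)
  define \<tau> where "\<tau> = transpose u (Suc u)"
  have inj: "inj \<tau>" by (simp add: \<tau>_def)
  have invol: "\<tau> (\<tau> v) = v" for v by (simp add: \<tau>_def)
  \<comment> \<open>Precomposing exponents with \<tau> is how \<tau> acts on monomials, because
    \<tau> is its own inverse.\<close>
  let ?P = "Poly_Mapping.map_key \<tau>"
  have lookP: "Poly_Mapping.lookup (?P k) v = Poly_Mapping.lookup k (\<tau> v)" for k :: "nat \<Rightarrow>\<^sub>0 nat" and v
    using inj by (simp add: map_key.rep_eq)
  have injP: "?P k = ?P l \<longleftrightarrow> k = l" for k l :: "nat \<Rightarrow>\<^sub>0 nat"
    by (metis invol lookP poly_mapping_eqI)
  have mon: "monom_at (\<lambda>v. Var (\<tau> v)) k = Poly_Mapping.single (?P k) 1" for k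
  proof -
    have "monom_at (\<lambda>v. Var (\<tau> v)) k = (\<Prod>w\<in>\<tau> ` Poly_Mapping.keys k. Var w ^ Poly_Mapping.lookup (?P k) w)"
      using inj by (simp add: monom_at_def prod.reindex inj_on_subset lookP invol)
    also have "\<tau> ` Poly_Mapping.keys k = Poly_Mapping.keys (?P k)"
      unfolding keys_map_key[OF inj] vimage_def by (auto simp: invol) (metis image_eqI invol)
    finally show ?thesis by (simp add: monom_at_Var[symmetric] monom_at_def)
  qed
  have "\<tau> permutes rset n"
    unfolding \<tau>_def using u by (intro permutes_swap_id) auto
  then have "f = subst (\<lambda>v. Var (\<tau> v)) f"
    using sym by (simp add: symmetric_def)
  then have "Poly_Mapping.lookup f (?P m) = Poly_Mapping.lookup (subst (\<lambda>v. Var (\<tau> v)) f) (?P m)"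
    by simp
  also have "\<dots> = (\<Sum>k\<in>Poly_Mapping.keys f. if m = k then Poly_Mapping.lookup f k else 0)"
    by (simp add: subst_altdef mon Const_def mult_single lookup_sum lookup_single when_def injP eq_commute)
  also have "\<dots> \<noteq> 0"
    using lead by (simp add: has_lead_def in_keys_iff)
  finally have "?P m \<le> m"
    using lead by (simp add: has_lead_def in_keys_iff)
  moreover assume "\<not> Poly_Mapping.lookup m (Suc u) \<le> Poly_Mapping.lookup m u"
  then have "m < ?P m"
    unfolding less_monom_iff
    by (intro exI[of _ u]) (auto simp: lookP, auto simp: \<tau>_def transpose_def)
  ultimately show False by simp
qed

section \<open>The fundamental theorem on symmetric polynomials\<close>

definition lead_exp :: "nat \<Rightarrow> (nat \<Rightarrow>\<^sub>0 nat) \<Rightarrow> (nat \<Rightarrow>\<^sub>0 nat)" where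
  "lead_exp n \<alpha> = (\<Sum>v<n. \<Sum>i<Poly_Mapping.lookup \<alpha> v. ind {n..<n + (n - v)})"

text \<open>Leading monomials add up, and variable \<open>v\<close> becomes a signed elementary
  symmetric polynomial of degree \<open>n - v\<close>, led by the segment of that length; the inner
  sum in \<open>lead_exp\<close> takes it with multiplicity.\<close>

lemma has_lead_monom_at_a_to_s:
  assumes "Poly_Mapping.keys \<alpha> \<subseteq> {..<n}"
  shows "has_lead (monom_at (a_to_s n) \<alpha>) (lead_exp n \<alpha>)"
  unfolding lead_exp_def monom_at_superset[OF finite_lessThan assms]
proof (intro has_lead_prod has_lead_power)
  fix v assume "v \<in> {..<n}"
  then show "has_lead (a_to_s n v) (ind {n..<n + (n - v)})"
    using has_lead_minus_one_power_mult[OF has_lead_esym[of "n - v" n]] by (simp add: a_to_s_def)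
qed

text \<open>Index \<open>2 * n - k\<close> lies in the segment of length \<open>n - v\<close> iff
  \<open>v < k\<close>, so the exponents, read from the last variable backwards, are partial sums of
  \<alpha>.\<close>

lemma lookup_lead_exp:
  assumes "k \<le> n" "0 < k"
  shows "Poly_Mapping.lookup (lead_exp n \<alpha>) (2 * n - k) = (\<Sum>v<k. Poly_Mapping.lookup \<alpha> v)"
proof -
  have "Poly_Mapping.lookup (lead_exp n \<alpha>) (2 * n - k)
      = (\<Sum>v<n. if v < k then Poly_Mapping.lookup \<alpha> v else 0)"
    unfolding lead_exp_def lookup_sum using assms
    by (intro sum.cong refl) (auto simp: lookup_ind)
  also have "\<dots> = (\<Sum>v<k. Poly_Mapping.lookup \<alpha> v)"
    using assms by (intro sum.mono_neutral_cong_right) auto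
  finally show ?thesis .
qed

lemma lookup_lead_exp_outside:
  "u \<notin> rset n \<Longrightarrow> Poly_Mapping.lookup (lead_exp n \<alpha>) u = 0"
  unfolding lead_exp_def lookup_sum by (auto simp: lookup_ind)

text \<open>Partial sums determine their terms.\<close>

lemma lead_exp_inject:
  assumes "Poly_Mapping.keys \<alpha> \<subseteq> {..<n}" "Poly_Mapping.keys \<beta> \<subseteq> {..<n}"
    and eq: "lead_exp n \<alpha> = lead_exp n \<beta>"
  shows "\<alpha> = \<beta>"
proof (rule poly_mapping_eqI)
  fix v
  have sums: "(\<Sum>v<k. Poly_Mapping.lookup \<alpha> v) = (\<Sum>v<k. Poly_Mapping.lookup \<beta> v)" if "k \<le> n" for k
    using that eq lookup_lead_exp[of k n \<alpha>] lookup_lead_exp[of k n \<beta>] by (cases "k = 0") auto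
  show "Poly_Mapping.lookup \<alpha> v = Poly_Mapping.lookup \<beta> v"
  proof (cases "v < n")
    case True
    then show ?thesis using sums[of v] sums[of "Suc v"] by simp
  next
    case False
    then have "v \<notin> Poly_Mapping.keys \<alpha>" "v \<notin> Poly_Mapping.keys \<beta>" using assms by auto
    then show ?thesis by (simp add: in_keys_iff)
  qed
qed

lemma lead_exp_surj:
  assumes keys: "Poly_Mapping.keys m \<subseteq> rset n"
    and dec: "\<And>u. n \<le> u \<Longrightarrow> Suc u < 2 * n \<Longrightarrow> Poly_Mapping.lookup m (Suc u) \<le> Poly_Mapping.lookup m u"
  obtains \<alpha> where "Poly_Mapping.keys \<alpha> \<subseteq> {..<n}" "lead_exp n \<alpha> = m"
proof
  \<comment> \<open>Differences invert the partial sums. The subtraction does not truncate since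
    \<open>m\<close> is decreasing; for \<open>v = 0\<close> the subtrahend is the exponent at
    \<open>2 * n\<close>, which is 0.\<close>
  let ?a = "\<lambda>v. Poly_Mapping.lookup m (2 * n - Suc v) - Poly_Mapping.lookup m (2 * n - v)"
  define \<alpha> where "\<alpha> = (\<Sum>v<n. Poly_Mapping.single v (?a v))"
  have look: "Poly_Mapping.lookup \<alpha> v = (if v < n then ?a v else 0)" for v
    by (simp add: \<alpha>_def lookup_sum lookup_single when_def)
  show "Poly_Mapping.keys \<alpha> \<subseteq> {..<n}"
    by (auto simp: in_keys_iff look split: if_splits)
  have top: "Poly_Mapping.lookup m (2 * n) = 0"
    using keys by (auto simp: in_keys_iff subset_iff)
  have sums: "(\<Sum>v<k. Poly_Mapping.lookup \<alpha> v) = Poly_Mapping.lookup m (2 * n - k)" if "k \<le> n" for k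
    using that
  proof (induction k)
    case (Suc k)
    have "Poly_Mapping.lookup m (2 * n - k) \<le> Poly_Mapping.lookup m (2 * n - Suc k)"
    proof (cases "k = 0")
      case False
      then show ?thesis using dec[of "2 * n - Suc k"] Suc.prems by (simp add: Suc_diff_Suc)
    qed (simp add: top)
    then show ?case using Suc by (simp add: look)
  qed (simp add: top)
  show "lead_exp n \<alpha> = m"
  proof (rule poly_mapping_eqI)
    fix u show "Poly_Mapping.lookup (lead_exp n \<alpha>) u = Poly_Mapping.lookup m u"
    proof (cases "u \<in> rset n")
      case True
      then have "u = 2 * n - (2 * n - u)" "2 * n - u \<le> n" "0 < 2 * n - u" by auto
      then show ?thesis using lookup_lead_exp[of "2 * n - u" n \<alpha>] sums[of "2 * n - u"] by simp
    next
      case False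
      then have "u \<notin> Poly_Mapping.keys m" using keys by auto
      then show ?thesis using False by (simp add: lookup_lead_exp_outside in_keys_iff)
    qed
  qed
qed

lemma lookup_Const_mult: "Poly_Mapping.lookup (Const c * p) m = c * Poly_Mapping.lookup p m"
  by (cases "m \<in> Poly_Mapping.keys p")
    (simp_all add: Const_def mult_map_scale_conv_mult[symmetric] map.rep_eq in_keys_iff)

text \<open>Algebraic independence: distinct monomials have images with distinct leading monomials,
  so the largest of these cannot cancel.\<close>

lemma subst_a_to_s_inject:
  assumes p: "vars_in {..<n} p" and zero: "subst (a_to_s n) p = 0"
  shows "p = 0"
proof (rule ccontr)
  assume "p \<noteq> 0"
  let ?K = "Poly_Mapping.keys p"
  have K: "Poly_Mapping.keys \<alpha> \<subseteq> {..<n}" if "\<alpha> \<in> ?K" for \<alpha>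
    using p that by (simp add: vars_in_def)
  have "Max (lead_exp n ` ?K) \<in> lead_exp n ` ?K"
    using \<open>p \<noteq> 0\<close> by (intro Max_in) auto
  then obtain \<alpha> where \<alpha>: "\<alpha> \<in> ?K" "lead_exp n \<alpha> = Max (lead_exp n ` ?K)"
    by (metis imageE)
  have le: "lead_exp n \<beta> \<le> lead_exp n \<alpha>" if "\<beta> \<in> ?K" for \<beta>
    using that \<alpha>(2) by simp
  have other: "Poly_Mapping.lookup (monom_at (a_to_s n) \<beta>) (lead_exp n \<alpha>) = 0"
    if "\<beta> \<in> ?K" "\<beta> \<noteq> \<alpha>" for \<beta>
  proof -
    have "lead_exp n \<beta> < lead_exp n \<alpha>"
      using le[of \<beta>] that K \<alpha> lead_exp_inject[of \<beta> n \<alpha>] by (auto simp: less_le)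
    then show ?thesis
      using has_lead_monom_at_a_to_s[OF K[OF that(1)]]
      by (auto simp: has_lead_def in_keys_iff dest!: leD)
  qed
  have "0 = Poly_Mapping.lookup (subst (a_to_s n) p) (lead_exp n \<alpha>)"
    by (simp add: zero)
  also have "\<dots> = (\<Sum>\<beta>\<in>?K. if \<alpha> = \<beta> then
      Poly_Mapping.lookup p \<alpha> * Poly_Mapping.lookup (monom_at (a_to_s n) \<alpha>) (lead_exp n \<alpha>) else 0)"
    unfolding subst_altdef lookup_sum lookup_Const_mult
    by (intro sum.cong refl) (auto simp: other)
  also have "\<dots> = Poly_Mapping.lookup p \<alpha> * Poly_Mapping.lookup (monom_at (a_to_s n) \<alpha>) (lead_exp n \<alpha>)"
    using \<alpha>(1) by simp
  also have "\<dots> \<noteq> 0"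
    using \<alpha>(1) has_lead_monom_at_a_to_s[OF K[OF \<alpha>(1)]] by (simp add: has_lead_def in_keys_iff)
  finally show False by simp
qed

text \<open>The leading exponents decrease along \<open>rset n\<close>, so \<open>m\<close> also
  leads some product of elementary symmetric polynomials. Subtracting a multiple of it lowers the
  leading monomial, and the induction is on that.\<close>

lemma symmetric_in_range_aux:
  assumes "has_lead f m" "vars_in (rset n) f" "symmetric n f"
  shows "\<exists>c. vars_in {..<n} c \<and> subst (a_to_s n) c = f"
  using assms
proof (induction m arbitrary: f rule: wf_induct_rule[OF wf_less_monom[of n "2 * n"]])
  case (1 m)
  note lead = \<open>has_lead f m\<close> and vars = \<open>vars_in (rset n) f\<close> and sym = \<open>symmetric n f\<close>
  have keys: "Poly_Mapping.keys m \<subseteq> rset n"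
    using lead vars by (simp add: has_lead_def vars_in_def)
  obtain \<alpha> where \<alpha>: "Poly_Mapping.keys \<alpha> \<subseteq> {..<n}" "lead_exp n \<alpha> = m"
    using lead_exp_surj[OF keys symmetric_lead_decreasing[OF sym lead]] by blast
  define g where "g = monom_at (a_to_s n) \<alpha>"
  have g: "g = subst (a_to_s n) (Poly_Mapping.single \<alpha> 1)"
    by (simp add: g_def subst_single)
  have va: "vars_in {..<n} (Poly_Mapping.single \<alpha> 1)"
    using \<alpha>(1) by (simp add: vars_in_def)
  have leadg: "has_lead g m"
    using has_lead_monom_at_a_to_s[OF \<alpha>(1)] \<alpha>(2) by (simp add: g_def)
  \<comment> \<open>The leading coefficient of \<open>g\<close>, which carries the signs of
    \<open>a_to_s\<close>, is divided out; it is nonzero since \<open>m\<close> is a key of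
    \<open>g\<close>.\<close>
  define r where "r = Poly_Mapping.lookup f m / Poly_Mapping.lookup g m"
  define f' where "f' = f - Const r * g"
  have varsf': "vars_in (rset n) f'"
    unfolding f'_def g by (intro vars_in_diff vars vars_in_mult vars_in_Const vars_in_subst_a_to_s va)
  have symf': "symmetric n f'"
    unfolding f'_def g by (intro symmetric_diff sym symmetric_mult symmetric_Const symmetric_subst_a_to_s va)
  have "\<exists>c. vars_in {..<n} c \<and> subst (a_to_s n) c = f'"
  proof (cases "f' = 0")
    case True
    then show ?thesis by (intro exI[of _ 0]) simp
  next
    case False
    then obtain m' where m': "has_lead f' m'" by (rule has_lead_exists)
    have m'f: "m' \<in> Poly_Mapping.keys f'" using m' by (simp add: has_lead_def)
    have "Poly_Mapping.lookup f' m = 0"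
      using leadg by (simp add: f'_def lookup_minus lookup_Const_mult r_def has_lead_def in_keys_iff)
    then have "m' \<noteq> m" using m'f by (auto simp: in_keys_iff)
    moreover have "m' \<le> m"
    proof (cases "m' \<in> Poly_Mapping.keys f")
      case False
      then have "m' \<in> Poly_Mapping.keys g"
        using m'f by (auto simp: f'_def lookup_minus lookup_Const_mult in_keys_iff)
      then show ?thesis using leadg by (simp add: has_lead_def)
    qed (use lead in \<open>simp add: has_lead_def\<close>)
    ultimately have "m' < m" by simp
    moreover have "Poly_Mapping.keys m' \<subseteq> rset n"
      using m'f varsf' by (simp add: vars_in_def)
    ultimately show ?thesis
      using "1.IH"[of m' f'] keys m' varsf' symf' by simp
  qed
  then obtain c where c: "vars_in {..<n} c" "subst (a_to_s n) c = f'" by blast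
  show ?case
  proof (intro exI conjI)
    show "vars_in {..<n} (c + Const r * Poly_Mapping.single \<alpha> 1)"
      by (intro vars_in_add vars_in_mult c vars_in_Const va)
    show "subst (a_to_s n) (c + Const r * Poly_Mapping.single \<alpha> 1) = f"
      by (simp add: subst_hom c g[symmetric] f'_def)
  qed
qed

lemma symmetric_in_range:
  assumes "vars_in (rset n) f" "symmetric n f"
  obtains c where "vars_in {..<n} c" "subst (a_to_s n) c = f"
proof (cases "f = 0")
  case True
  then show ?thesis using that[of 0] by simp
next
  case False
  then show ?thesis using has_lead_exists symmetric_in_range_aux assms that by metis
qed

subsection \<open>The linear factors\<close>

text \<open>Vanishes exactly where \<open>a\<close> is the midpoint of \<open>b\<close> and
  \<open>c\<close>.\<close>

definition midform :: "nat \<Rightarrow> nat \<Rightarrow> nat \<Rightarrow> mpoly" where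
  "midform a b c = 2 * Var a - Var b - Var c"

text \<open>Modulo the form, variable \<open>a\<close> equals the mean of the other two.
  Divisibility thus becomes membership in the kernel of a substitution.\<close>

lemma midform_dvd_iff:
  assumes "a \<noteq> b" "a \<noteq> c"
  shows "midform a b c dvd f \<longleftrightarrow> subst (Var(a := Const (1 / 2) * (Var b + Var c))) f = 0"
    (is "_ \<longleftrightarrow> subst ?\<sigma> f = 0")
proof
  have half: "2 * (Const (1 / 2) * p) = p" for p
    using Const_mult[of 2 "1 / 2"] by (simp add: mult.assoc[symmetric])
  assume "midform a b c dvd f"
  then obtain h where "f = midform a b c * h" by (auto simp: dvd_def)
  moreover have "subst ?\<sigma> (midform a b c) = 0"
    using assms by (simp add: midform_def subst_hom half)
  ultimately show "subst ?\<sigma> f = 0" by (simp add: subst_mult)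
next
  have "Const (1 / 2) * 2 = 1"
    using Const_mult[of "1 / 2" 2] by simp
  then have "Const (1 / 2) * midform a b c = Var a - Const (1 / 2) * (Var b + Var c)"
    by (simp add: midform_def right_diff_distrib distrib_left mult.assoc[symmetric])
  then have "midform a b c dvd Var a - Const (1 / 2) * (Var b + Var c)"
    by (metis dvd_triv_right)
  then have "f - subst ?\<sigma> f \<in> ideal_gen [midform a b c]"
    by (intro ideal_gen_subst_congruent) (auto simp: ideal_gen_singleton)
  then show "subst ?\<sigma> f = 0 \<Longrightarrow> midform a b c dvd f"
    by (simp add: ideal_gen_singleton)
qed

text \<open>The kernel of a homomorphism into a domain is prime.\<close>

lemma midform_prime:
  assumes "a \<noteq> b" "a \<noteq> c" "midform a b c dvd f * g"
  shows "midform a b c dvd f \<or> midform a b c dvd g"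
  using assms by (simp add: midform_dvd_iff subst_mult)

lemma midform_dvd_midform:
  assumes "midform a b c dvd midform a' b' c'"
    and distinct: "distinct [a, b, c]" "distinct [a', b', c']"
  shows "a' = a \<and> {b', c'} = {b, c}"
proof -
  \<comment> \<open>Compare the two hyperplanes through rational points.\<close>
  have eval: "2 * x a' = x b' + x c'" if "2 * x a = x b + x c" for x :: "nat \<Rightarrow> rat"
  proof -
    have *: "subst (\<lambda>v. Const (x v)) (midform p q r) = Const (2 * x p - x q - x r)" for p q r
      by (simp add: midform_def subst_hom Const_diff Const_mult)
    obtain h where "midform a' b' c' = midform a b c * h"
      using assms by (auto simp: dvd_def)
    then have "subst (\<lambda>v. Const (x v)) (midform a' b' c') = 0"
      using that by (simp add: subst_mult *)
    then show ?thesis by (simp add: *)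
  qed
  \<comment> \<open>Otherwise the point with coordinate 1 at \<open>w\<close> and 0 elsewhere
    satisfies the first equation but not the second.\<close>
  have sub: "w \<in> {a, b, c}" if "w \<in> {a', b', c'}" for w
  proof (rule ccontr)
    assume "w \<notin> {a, b, c}"
    then have "2 * (if a' = w then 1 else 0) = (if b' = w then 1 else 0) + (if c' = w then 1 else (0::rat))"
      using eval[of "\<lambda>v. if v = w then 1 else 0"] by auto
    then show False using that distinct(2) by (auto split: if_splits)
  qed
  \<comment> \<open>The point with \<open>b\<close> at 1, \<open>c\<close> at -1 and 0 elsewhere
    lies on the first hyperplane; with \<open>sub\<close> this excludes \<open>b\<close> and
    \<open>c\<close> as values of \<open>a'\<close>.\<close>
  have "2 * (if a' = b then 1 else if a' = c then -1 else 0)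
      = (if b' = b then 1 else if b' = c then -1 else 0) + (if c' = b then 1 else if c' = c then -1 else (0::rat))"
    using distinct(1) eval[of "\<lambda>v. if v = b then 1 else if v = c then -1 else 0"] by auto
  then show ?thesis
    using sub[of a'] sub[of b'] sub[of c'] distinct by (auto split: if_splits)
qed

text \<open>Write \<open>f\<close> as the product over \<open>S\<close> times \<open>h\<close>. The
  new prime divides no factor of that product, so it must divide \<open>h\<close>.\<close>

lemma prod_dvd_of_primes:
  fixes L :: "'a \<Rightarrow> 'b :: comm_semiring_1"
  assumes "finite S"
    and prime: "\<And>t f g. t \<in> S \<Longrightarrow> L t dvd f * g \<Longrightarrow> L t dvd f \<or> L t dvd g"
    and indep: "\<And>s t. s \<in> S \<Longrightarrow> t \<in> S \<Longrightarrow> L t dvd L s \<Longrightarrow> s = t"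
    and nonunit: "\<And>t. t \<in> S \<Longrightarrow> \<not> L t dvd 1"
    and "\<And>t. t \<in> S \<Longrightarrow> L t dvd f"
  shows "(\<Prod>t\<in>S. L t) dvd f"
  using assms
proof (induction S rule: finite_induct)
  case (insert t S)
  note prime = insert.prems(1) and indep = insert.prems(2) and nonunit = insert.prems(3)
  obtain h where h: "f = (\<Prod>s\<in>S. L s) * h" using insert by (auto simp: dvd_def)
  have "\<not> L t dvd (\<Prod>s\<in>S'. L s)" if "S' \<subseteq> S" for S'
    using finite_subset[OF that \<open>finite S\<close>] that
  proof (induction S' rule: finite_induct)
    case empty
    then show ?case using nonunit by simp
  next
    case (insert s S')
    have "\<not> L t dvd L s" using insert.prems \<open>t \<notin> S\<close> indep[of s t] by auto
    then show ?case
      using insert prime[of t "L s" "\<Prod>s\<in>S'. L s"] by auto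
  qed
  moreover have "L t dvd (\<Prod>s\<in>S. L s) * h"
    using insert.prems(4)[of t] h by simp
  ultimately have "L t dvd h"
    using prime[of t "\<Prod>s\<in>S. L s" h] by blast
  then show ?case
    using h insert.hyps by (auto simp: dvd_def mult.assoc mult.left_commute)
qed simp

text \<open>Three transpositions in turn put one image each into place; injectivity keeps the later
  ones away from the values already set.\<close>

lemma permutes_extend_triple:
  assumes "distinct [a, b, c]" "distinct [a', b', c']" "{a, b, c, a', b', c'} \<subseteq> R"
  obtains \<tau> where "\<tau> permutes R" "\<tau> a = a'" "\<tau> b = b'" "\<tau> c = c'"
proof
  let ?f = "transpose a a'"
  let ?g = "transpose (?f b) b' \<circ> ?f"
  let ?h = "transpose (?g c) c' \<circ> ?g"
  have f: "?f permutes R" using assms by (intro permutes_swap_id) auto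
  have "?f b \<in> R" using permutes_in_image[OF f] assms by auto
  then have g: "?g permutes R" using assms by (intro permutes_compose[OF f] permutes_swap_id) auto
  have "?g c \<in> R" using permutes_in_image[OF g] assms by auto
  then show h: "?h permutes R" using assms by (intro permutes_compose[OF g] permutes_swap_id) auto
  have inj: "inj ?f" "inj ?g" using f g by (simp_all add: permutes_inj)
  have "?f a = a'" by simp
  then have "?f b \<noteq> a'" using inj(1) assms(1) by (metis distinct_length_2_or_more injD)
  then have ga: "?g a = a'" and gb: "?g b = b'" using assms by (auto simp: transpose_def)
  then have "?g c \<noteq> a'" "?g c \<noteq> b'" using inj(2) assms(1) by (metis distinct_length_2_or_more injD)+
  then have "transpose (?g c) c' a' = a'" "transpose (?g c) c' b' = b'"
    using assms by (auto simp: transpose_def)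
  then show "?h a = a'" "?h b = b'" "?h c = c'"
    using ga gb by (simp_all only: comp_apply transpose_apply_first)
qed

text \<open>A permutation carries one form to the other and leaves \<open>f\<close>
  unchanged.\<close>

lemma symmetric_midform_dvd:
  assumes "symmetric n f" "midform a b c dvd f"
    and "distinct [a, b, c]" "distinct [a', b', c']" "{a, b, c, a', b', c'} \<subseteq> rset n"
  shows "midform a' b' c' dvd f"
proof -
  obtain \<tau> where \<tau>: "\<tau> permutes rset n" "\<tau> a = a'" "\<tau> b = b'" "\<tau> c = c'"
    using permutes_extend_triple assms(3-5) by metis
  obtain h where "f = midform a b c * h" using assms(2) by (auto simp: dvd_def)
  then have "subst (\<lambda>v. Var (\<tau> v)) f = midform a' b' c' * subst (\<lambda>v. Var (\<tau> v)) h"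
    using \<tau> by (simp add: midform_def subst_hom)
  then show ?thesis using assms(1) \<tau>(1) by (simp add: symmetric_def)
qed

section \<open>The product of all conjugate forms\<close>

definition triples :: "nat \<Rightarrow> (nat \<times> nat \<times> nat) set" where
  "triples n = {(i,j,k). i \<in> {1..n} \<and> j \<in> {1..n} \<and> k \<in> {1..n} \<and> i < j \<and> j \<noteq> k \<and> k \<noteq> i}"

text \<open>The midpoint is the third component; the form is symmetric in the other two, which is
  why \<open>triples\<close> orders them.\<close>

definition factor :: "nat \<Rightarrow> nat \<times> nat \<times> nat \<Rightarrow> mpoly" where
  "factor n = (\<lambda>(i,j,k). midform (n + k - 1) (n + i - 1) (n + j - 1))"

lemma finite_triples: "finite (triples n)"
  by (rule finite_subset[of _ "{1..n} \<times> {1..n} \<times> {1..n}"]) (auto simp: triples_def)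

lemma Pprod_eq: "Pprod n = (\<Prod>t\<in>triples n. factor n t)"
  by (simp add: Pprod_def triples_def factor_def midform_def rvar_def split_def)

lemma midform_not_unit:
  assumes "a \<noteq> b" "a \<noteq> c" shows "\<not> midform a b c dvd 1"
  using assms by (simp add: midform_dvd_iff)

lemma midform_nonzero:
  assumes "distinct [a, b, c]" shows "midform a b c \<noteq> 0"
proof
  assume "midform a b c = 0"
  \<comment> \<open>Everything divides 0, even a form with another midpoint.\<close>
  then have "midform b a c dvd midform a b c" by simp
  then show False using midform_dvd_midform[of b a c a b c] assms by auto
qed

lemma Pprod_nonzero: "Pprod n \<noteq> 0"
proof -
  have "factor n t \<noteq> 0" if "t \<in> triples n" for t
    using that by (auto simp: triples_def factor_def intro!: midform_nonzero)
  then show ?thesis by (simp add: Pprod_eq finite_triples)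
qed

lemma vars_in_Pprod: "vars_in (rset n) (Pprod n)"
  unfolding Pprod_eq
  by (intro vars_in_prod)
    (auto simp: triples_def factor_def midform_def intro!: vars_in_diff vars_in_mult vars_in_Var)

lemma Pprod_dvd_symmetric:
  assumes n: "n \<ge> 3" and sym: "symmetric n f" and dvd: "midform n (n + 1) (n + 2) dvd f"
  shows "Pprod n dvd f"
  unfolding Pprod_eq
proof (rule prod_dvd_of_primes[OF finite_triples])
  fix t assume t: "t \<in> triples n"
  obtain i j k where [simp]: "t = (i, j, k)" by (cases t)
  show "factor n t dvd f"
    unfolding factor_def \<open>t = (i, j, k)\<close> prod.case
    by (rule symmetric_midform_dvd[OF sym dvd]) (use n t in \<open>auto simp: triples_def\<close>)
  show "\<not> factor n t dvd 1"
    using t unfolding factor_def \<open>t = (i, j, k)\<close> prod.case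
    by (intro midform_not_unit) (auto simp: triples_def)
  show "factor n t dvd g \<or> factor n t dvd h" if "factor n t dvd g * h" for g h
    using that t unfolding factor_def \<open>t = (i, j, k)\<close> prod.case
    by (intro midform_prime) (auto simp: triples_def)
  show "s = t" if "s \<in> triples n" "factor n t dvd factor n s" for s
  proof -
    obtain i' j' k' where [simp]: "s = (i', j', k')" by (cases s)
    have "midform (n + k - 1) (n + i - 1) (n + j - 1) dvd midform (n + k' - 1) (n + i' - 1) (n + j' - 1)"
      using that(2) by (simp add: factor_def)
    then have "n + k' - 1 = n + k - 1 \<and> {n + i' - 1, n + j' - 1} = {n + i - 1, n + j - 1}"
      by (rule midform_dvd_midform) (use that(1) t in \<open>auto simp: triples_def\<close>)
    moreover have "n + x - 1 = n + y - 1 \<longleftrightarrow> x = y" for x y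
      using n by auto
    ultimately have "k' = k" "i' = i \<and> j' = j \<or> i' = j \<and> j' = i"
      by (simp_all only: doubleton_eq_iff)
    \<comment> \<open>The ordering of the outer indices rules out the swapped case.\<close>
    moreover have "i < j" "i' < j'" using that(1) t by (simp_all add: triples_def)
    ultimately show ?thesis by auto
  qed
qed

text \<open>Cancelling \<open>g\<close> shows that the quotient is again symmetric, so the
  fundamental theorem applies to it.\<close>

lemma symmetric_dvd_in_range:
  assumes p: "vars_in (rset n) p" "symmetric n p" and g: "vars_in (rset n) g" "symmetric n g" "g \<noteq> 0"
    and dvd: "g dvd p"
  obtains c where "vars_in {..<n} c" "p = subst (a_to_s n) c * g"
proof -
  obtain h where h: "p = g * h" using dvd by (auto simp: dvd_def)
  \<comment> \<open>A priori \<open>h\<close> may involve variables outside \<open>rset n\<close>; they are set to \<open>0\<close>.\<close>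
  let ?\<rho> = "\<lambda>v. if v \<in> rset n then Var v else 0"
  define q where "q = subst ?\<rho> h"
  have q: "p = g * q"
    using arg_cong[OF h, of "subst ?\<rho>"] subst_id_on[OF p(1), of ?\<rho>] subst_id_on[OF g(1), of ?\<rho>]
    by (simp add: subst_mult q_def)
  have vars: "vars_in (rset n) q"
    unfolding q_def by (rule vars_in_subst[of UNIV]) auto
  have "symmetric n q"
    unfolding symmetric_def
  proof (intro allI impI)
    fix \<tau> assume \<tau>: "\<tau> permutes rset n"
    have "g * subst (\<lambda>v. Var (\<tau> v)) q = g * q"
      using p(2) g(2) \<tau> arg_cong[OF q, of "subst (\<lambda>v. Var (\<tau> v))"] q
      by (simp add: symmetric_def subst_mult)
    then show "subst (\<lambda>v. Var (\<tau> v)) q = q" using g(3) by simp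
  qed
  then obtain c where "vars_in {..<n} c" "subst (a_to_s n) c = q"
    using symmetric_in_range vars by metis
  then show ?thesis using that q by (simp add: mult.commute)
qed

subsection \<open>Elimination\<close>

lemma subst_a_to_s_vgen:
  assumes "1 \<le> i" "i \<le> n" shows "subst (a_to_s n) (vgen n i) = 0"
proof -
  have "subst (a_to_s n) (esym n i) = esym n i"
    by (rule subst_id_on[OF vars_in_esym]) (simp add: a_to_s_def)
  then show ?thesis
    using assms by (simp add: vgen_def avar_def subst_hom a_to_s_def)
qed

text \<open>Turns elimination into divisibility: \<open>a_to_s\<close> kills every
  \<open>v_i\<close> and fixes \<open>g\<close>, while \<open>p\<close> is congruent to its image
  modulo the \<open>v_i\<close>.\<close>

lemma mem_ideal_vgen_iff:
  assumes g: "vars_in (rset n) g"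
  shows "p \<in> ideal_gen (g # map (vgen n) [1..<n+1]) \<longleftrightarrow> g dvd subst (a_to_s n) p"
    (is "p \<in> ideal_gen ?gs \<longleftrightarrow> _")
proof
  have phig: "subst (a_to_s n) g = g"
    by (rule subst_id_on[OF g]) (simp add: a_to_s_def)
  have dvd: "g dvd subst (a_to_s n) x" if "x \<in> set ?gs" for x
    using that phig by (auto simp: subst_a_to_s_vgen)
  assume "p \<in> ideal_gen ?gs"
  then obtain c where "p = (\<Sum>i<length ?gs. c i * ?gs ! i)"
    by (auto simp: ideal_gen_def)
  moreover have "g dvd subst (a_to_s n) (\<Sum>i<length ?gs. c i * ?gs ! i)"
    unfolding subst_sum subst_mult by (intro dvd_sum dvd_mult dvd nth_mem) simp
  ultimately show "g dvd subst (a_to_s n) p" by simp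
next
  assume "g dvd subst (a_to_s n) p"
  then obtain h where h: "subst (a_to_s n) p = h * g" by (metis dvdE mult.commute)
  \<comment> \<open>For \<open>v < n\<close> the difference is the generator with index
    \<open>n - v\<close>; otherwise it is 0.\<close>
  have "Var v - a_to_s n v \<in> ideal_gen ?gs" for v
  proof (cases "v < n")
    case True
    then have "Var v - a_to_s n v = vgen n (n - v)" by (simp add: vgen_def avar_def a_to_s_def)
    moreover have "vgen n (n - v) \<in> vgen n ` {1..<n+1}" using True by (intro imageI) auto
    ultimately show ?thesis by (intro ideal_gen_generator) (simp del: upt_Suc)
  qed (simp add: a_to_s_def ideal_gen_0)
  then have "p - subst (a_to_s n) p \<in> ideal_gen ?gs"
    by (rule ideal_gen_subst_congruent)
  moreover have "subst (a_to_s n) p \<in> ideal_gen ?gs"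
    unfolding h by (intro ideal_gen_mult ideal_gen_generator) simp
  ultimately have "(p - subst (a_to_s n) p) + subst (a_to_s n) p \<in> ideal_gen ?gs"
    by (rule ideal_gen_add)
  then show "p \<in> ideal_gen ?gs" by simp
qed

text \<open>The hypotheses pin down \<open>D2\<close>, by \<open>subst_a_to_s_inject\<close>. The
  last set is the ideal of \<open>D2\<close> inside the ring of a-polynomials, whereas
  \<open>ideal_gen\<close> allows coefficients in all variables.\<close>

theorem proposition7:
  fixes n :: nat and D2 :: mpoly
  assumes "n \<ge> 3"
    and "in_Qa n D2"
    and "subst (a_to_s n) D2 = Pprod n"
  shows "ideal_gen (Pprod n # map (vgen n) [1..<n+1]) \<inter> {p. in_Qa n p}
           = ideal_gen ((2 * rvar n 1 - rvar n 2 - rvar n 3) # map (vgen n) [1..<n+1]) \<inter> {p. in_Qa n p}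
       \<and> ideal_gen ((2 * rvar n 1 - rvar n 2 - rvar n 3) # map (vgen n) [1..<n+1]) \<inter> {p. in_Qa n p}
           = {c * D2 | c. in_Qa n c}"
proof -
  let ?\<phi> = "subst (a_to_s n)"
  let ?L = "midform n (n + 1) (n + 2)"
  have L: "2 * rvar n 1 - rvar n 2 - rvar n 3 = ?L"
    by (simp add: rvar_def midform_def)
  have varsL: "vars_in (rset n) ?L"
    unfolding midform_def using \<open>n \<ge> 3\<close> by (intro vars_in_diff vars_in_mult vars_in_Var) auto
  have D2: "vars_in {..<n} D2" using assms(2) by (simp add: in_Qa_iff_vars_in)
  \<comment> \<open>Symmetry comes for free from \<open>Pprod n\<close> being an image under
    \<open>a_to_s\<close>.\<close>
  have symP: "symmetric n (Pprod n)"
    using symmetric_subst_a_to_s[OF D2] assms(3) by simp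
  \<comment> \<open>The triple \<open>i = 2\<close>, \<open>j = 3\<close>, \<open>k = 1\<close>
    yields \<open>2 r_1 - r_2 - r_3\<close>.\<close>
  have "factor n (2, 3, 1) dvd Pprod n"
    unfolding Pprod_eq using \<open>n \<ge> 3\<close> by (intro dvd_prodI finite_triples) (simp add: triples_def)
  then have LP: "?L dvd Pprod n" by (simp add: factor_def)
  have forward: "\<exists>c. in_Qa n c \<and> p = c * D2" if p: "in_Qa n p" and "?L dvd ?\<phi> p" for p
  proof -
    have vp: "vars_in {..<n} p" using p by (simp add: in_Qa_iff_vars_in)
    note sym = symmetric_subst_a_to_s[OF vp]
    have "Pprod n dvd ?\<phi> p"
      by (rule Pprod_dvd_symmetric[OF \<open>n \<ge> 3\<close> sym that(2)])
    then obtain c where c: "vars_in {..<n} c" "?\<phi> p = ?\<phi> c * Pprod n"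
      using symmetric_dvd_in_range[OF vars_in_subst_a_to_s[OF vp] sym vars_in_Pprod symP Pprod_nonzero]
      by metis
    \<comment> \<open>Injectivity of \<phi> on a-polynomials lifts the factorization of the image
      back to \<open>p\<close>.\<close>
    have "vars_in {..<n} (p - c * D2)" by (intro vars_in_diff vars_in_mult vp c D2)
    moreover have "?\<phi> (p - c * D2) = 0" using c(2) assms(3) by (simp add: subst_hom)
    ultimately have "p - c * D2 = 0" by (rule subst_a_to_s_inject)
    then show ?thesis using c(1) by (auto simp: in_Qa_iff_vars_in)
  qed
  have backward: "in_Qa n (c * D2) \<and> Pprod n dvd ?\<phi> (c * D2)" if "in_Qa n c" for c
    using that D2 assms(3) by (simp add: in_Qa_iff_vars_in vars_in_mult subst_mult)
  \<comment> \<open>A cycle for a-polynomials: divisibility of the image by \<open>Pprod n\<close>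
    implies divisibility by \<open>?L\<close>, hence a multiple of \<open>D2\<close>, hence
    divisibility by \<open>Pprod n\<close>.\<close>
  have "in_Qa n p \<and> Pprod n dvd ?\<phi> p \<longleftrightarrow> (\<exists>c. p = c * D2 \<and> in_Qa n c)"
    and "in_Qa n p \<and> ?L dvd ?\<phi> p \<longleftrightarrow> (\<exists>c. p = c * D2 \<and> in_Qa n c)" for p
    using forward[of p] backward dvd_trans[OF LP] by blast+
  then show ?thesis
    unfolding L set_eq_iff Int_iff mem_Collect_eq
      mem_ideal_vgen_iff[OF varsL] mem_ideal_vgen_iff[OF vars_in_Pprod]
    by blast
qed

end
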